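(* Let $T:\mathbb{R}\rightrightarrows\mathbb{R}$ be a set-valued mapping whose graph $\operatorname{gph}T$ is a path-connected subset of $\mathbb{R}^2$. If $T$ is locally monotone around every point of its graph, then $T$ is globally monotone on $\mathbb{R}$.
   Context: A set-valued mapping $T:\mathbb{R}\rightrightarrows\mathbb{R}$ assigns to each $x\in\mathbb{R}$ a (possibly empty) subset $T(x)\subset\mathbb{R}$; its graph is $\operatorname{gph}T:=\{(x,x^* )\in\mathbb{R}\times\mathbb{R} : x^*\in T(x)\}$. All set-valued mappings are assumed proper, i.e., with nonempty graph. A subset $S$ of a topological space is path-connected if for any two points $x\ne y$ of $S$ there is a continuous map $\varphi:[0,1]\to S$ with $\varphi(0)=x$ and $\varphi(1)=y$. $T$ is (globally) monotone on $\mathbb{R}$ if $(x^*-y^* )(x-y)\ge 0$ for all $(x,x^* ),(y,y^* )\in\operatorname{gph}T$. $T$ is locally monotone around $(u,u^* )\in\operatorname{gph}T$ if there exists a neighborhood $W\subset\mathbb{R}^2$ of $(u,u^* )$ such that $(x^*-y^* )(x-y)\ge 0$ for all $(x,x^* ),(y,y^* )\in\operatorname{gph}T\cap W$. *)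

theory Defs
  imports "HOL-Analysis.Analysis"
begin

definition gph :: "(real \<Rightarrow> real set) \<Rightarrow> (real \<times> real) set" where
  "gph T = {(x, xs). xs \<in> T x}"

definition proper_map_sv :: "(real \<Rightarrow> real set) \<Rightarrow> bool" where
  "proper_map_sv T \<longleftrightarrow> gph T \<noteq> {}"

definition monotone_sv :: "(real \<Rightarrow> real set) \<Rightarrow> bool" where
  "monotone_sv T \<longleftrightarrow>
     (\<forall>(x, xs) \<in> gph T. \<forall>(y, ys) \<in> gph T. (xs - ys) * (x - y) \<ge> 0)"

(* Only meant for points p of gph T. Taking W open loses nothing, since the
   condition passes to subsets of W. *)
definition locally_monotone_sv :: "(real \<Rightarrow> real set) \<Rightarrow> real \<times> real \<Rightarrow> bool" where
  "locally_monotone_sv T p \<longleftrightarrow>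
     (\<exists>W. open W \<and> p \<in> W \<and>
       (\<forall>(x, xs) \<in> gph T \<inter> W. \<forall>(y, ys) \<in> gph T \<inter> W. (xs - ys) * (x - y) \<ge> 0))"

end

theory Submission
  imports Defs
begin

text \<open>
  Call two points of the plane comparable if one lies weakly below the other in both
  coordinates; monotonicity of \<open>T\<close> says that any two points of its graph are comparable.
  Following Minty, use the coordinate sum \<open>s (x, y) = x + y\<close>: on a set of pairwise comparable
  points \<open>s\<close> is injective, and the order of \<open>s\<close>-values decides which of two points is the
  lower one.

  A path in the graph can reverse its direction and retrace itself, so along an arbitrary
  path local comparability cannot simply be chained.  This is avoided by joining two points of the
  graph by an arc, which exists because path-connected sets in the plane are arcwise
  connected.  Along an arc \<open>s\<close> is locally injective, since comparable points with equal \<open>s\<close>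
  coincide and the arc is injective.  A continuous locally injective real function on an interval
  has no interior extremum, hence is injective
  (\<open>locally_injective_imp_inj_on\<close>) and so strictly monotone.  With the endpoints ordered so that
  \<open>s\<close> increases, nearby points of the arc are ordered in both coordinates by their parameter.
  This order is transitive, so the local relation propagates to the two endpoints.
\<close>

text \<open>
  If \<open>f x = f y\<close> with \<open>x < y\<close>, the maximum or the minimum of \<open>f\<close> over \<open>{x..y}\<close> is
  attained at an interior point.  A continuous function that is injective near that point is
  strictly monotone there, so it cannot have an extremum.
\<close>

lemma locally_injective_imp_inj_on:
  fixes f :: "real \<Rightarrow> real"
  assumes cont: "continuous_on {a..b} f"
    and loc: "\<And>t. t \<in> {a..b} \<Longrightarrow> \<exists>e>0. inj_on f ({a..b} \<inter> ball t e)"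
  shows "inj_on f {a..b}"
proof (rule linorder_inj_onI)
  fix x y assume xy: "x < y" "x \<in> {a..b}" "y \<in> {a..b}"
  have no_extremum: False
    if t: "x < t" "t < y"
      and ext: "(\<forall>z\<in>{x..y}. f z \<le> f t) \<or> (\<forall>z\<in>{x..y}. f t \<le> f z)" for t
  proof -
    obtain e where e: "e > 0" "inj_on f ({a..b} \<inter> ball t e)"
      using loc[of t] t xy by auto
    define d where "d = min (e/2) (min (t - x) (y - t))"
    have d: "d > 0" "d < e" "x \<le> t - d" "t + d \<le> y"
      using e t by (auto simp: d_def min_def)
    have sub: "{t-d..t+d} \<subseteq> {a..b} \<inter> ball t e"
      using d xy by (auto simp: dist_real_def)
    have "(f (t-d) < f t \<and> f t < f (t+d)) \<or> (f (t+d) < f t \<and> f t < f (t-d))"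
    proof (rule continuous_inj_imp_mono[where f = f])
      show "continuous_on {t-d..t+d} f"
        using continuous_on_subset[OF cont] sub by blast
      show "inj_on f {t-d..t+d}"
        using inj_on_subset[OF e(2) sub] .
    qed (use d in auto)
    moreover have "t - d \<in> {x..y}" "t + d \<in> {x..y}"
      using d by auto
    ultimately show False
      using ext by (meson less_le_not_le)
  qed
  have cont': "continuous_on {x..y} f"
    using cont xy by (auto intro: continuous_on_subset)
  obtain u where u: "u \<in> {x..y}" "\<forall>z\<in>{x..y}. f z \<le> f u"
    using continuous_attains_sup[OF compact_Icc _ cont'] xy by auto
  obtain l where l: "l \<in> {x..y}" "\<forall>z\<in>{x..y}. f l \<le> f z"
    using continuous_attains_inf[OF compact_Icc _ cont'] xy by auto
  show "f x \<noteq> f y"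
  proof
    assume eq: "f x = f y"
    have "u = x \<or> u = y" "l = x \<or> l = y"
      using no_extremum[of u] no_extremum[of l] u l by fastforce+
    \<comment> \<open>Both extrema are then attained at the endpoints, so \<open>f\<close> is constant on \<open>{x..y}\<close>
      and the midpoint is an extremum as well.\<close>
    then have "f u = f x" "f l = f x"
      using eq by auto
    then have const: "f z = f x" if "z \<in> {x..y}" for z
      using u(2) l(2) that by (metis order_antisym)
    have mid: "x < (x+y)/2" "(x+y)/2 < y"
      using xy by auto
    then have "f ((x+y)/2) = f x"
      by (intro const) auto
    then have "\<forall>z\<in>{x..y}. f z \<le> f ((x+y)/2)"
      using const by (metis order_refl)
    then show False
      using no_extremum[OF mid] by blast
  qed
qed auto

text \<open>
  The coordinate sum is strictly increasing along the arc; the inequality between the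
  endpoint sums only chooses this orientation.  For nearby parameters \<open>u < v\<close>, comparability of
  \<open>g u\<close> and \<open>g v\<close> then forces \<open>g u\<close> to be the lower point.  Transitivity carries this to the
  endpoints by bisection of the parameter interval.
\<close>

lemma arc_locally_comparable_imp_le:
  fixes g :: "real \<Rightarrow> real \<times> real"
  assumes arc: "arc g"
    and loc: "\<And>t. t \<in> {0..1} \<Longrightarrow> \<exists>e>0. \<forall>u \<in> {0..1} \<inter> ball t e. \<forall>v \<in> {0..1} \<inter> ball t e.
                (snd (g u) - snd (g v)) * (fst (g u) - fst (g v)) \<ge> 0"
    and le: "fst (g 0) + snd (g 0) \<le> fst (g 1) + snd (g 1)"
  shows "fst (g 0) \<le> fst (g 1) \<and> snd (g 0) \<le> snd (g 1)"
proof -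
  define s where "s t = fst (g t) + snd (g t)" for t
  have cont: "continuous_on {0..1} s"
    unfolding s_def using arc by (auto simp: arc_def path_def intro!: continuous_intros)
  have inj: "inj_on s {0..1}"
  proof (rule locally_injective_imp_inj_on[OF cont])
    fix t :: real assume "t \<in> {0..1}"
    then obtain e where e: "e > 0" "\<And>u v. u \<in> {0..1} \<inter> ball t e \<Longrightarrow> v \<in> {0..1} \<inter> ball t e \<Longrightarrow>
        (snd (g u) - snd (g v)) * (fst (g u) - fst (g v)) \<ge> 0"
      using loc by meson
    have "inj_on s ({0..1} \<inter> ball t e)"
    proof (rule inj_onI)
      fix u v assume uv: "u \<in> {0..1} \<inter> ball t e" "v \<in> {0..1} \<inter> ball t e" and "s u = s v"
      then have "snd (g u) - snd (g v) = - (fst (g u) - fst (g v))"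
        by (simp add: s_def)
      \<comment> \<open>Comparability turns this into \<open>- (fst (g u) - fst (g v))\<^sup>2 \<ge> 0\<close>.\<close>
      with e(2)[OF uv] have "fst (g u) = fst (g v)"
        by (auto simp: zero_le_mult_iff)
      with \<open>s u = s v\<close> have "g u = g v"
        by (simp add: s_def prod_eq_iff)
      with arc uv show "u = v"
        by (auto simp: arc_def inj_on_def)
    qed
    with e show "\<exists>e>0. inj_on s ({0..1} \<inter> ball t e)" by blast
  qed
  have incr: "s u < s v" if "0 \<le> u" "u < v" "v \<le> 1" for u v
  proof -
    have "strict_mono_on {0..1} s \<or> strict_antimono_on {0..1} s"
      using injective_eq_monotone_map[OF is_interval_cc cont] inj by blast
    moreover have "\<not> strict_antimono_on {0..1} s"
      using le monotone_onD[of "{0..1}" "(<)" "(>)" s 0 1] by (auto simp: s_def)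
    ultimately show ?thesis
      using that by (auto simp: monotone_on_def)
  qed
  let ?P = "\<lambda>u v. 0 \<le> u \<longrightarrow> v \<le> 1 \<longrightarrow> fst (g u) \<le> fst (g v) \<and> snd (g u) \<le> snd (g v)"
  have "?P 0 1"
  proof (rule Bolzano[where P = ?P])
    show "(0::real) \<le> 1" by simp
  next
    fix u v w assume "?P u v" "?P v w" "u \<le> v" "v \<le> w"
    then show "?P u w" by force
  next
    fix t :: real assume "0 \<le> t" "t \<le> 1"
    then obtain e where e: "e > 0" "\<And>u v. u \<in> {0..1} \<inter> ball t e \<Longrightarrow> v \<in> {0..1} \<inter> ball t e \<Longrightarrow>
        (snd (g u) - snd (g v)) * (fst (g u) - fst (g v)) \<ge> 0"
      using loc by (meson atLeastAtMost_iff)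
    have "fst (g u) \<le> fst (g v) \<and> snd (g u) \<le> snd (g v)"
      if uv: "u \<le> t" "t \<le> v" "v - u < e" "0 \<le> u" "v \<le> 1" for u v
    proof (cases "u = v")
      case False
      then have "s u < s v" using incr uv by auto
      moreover have "(snd (g u) - snd (g v)) * (fst (g u) - fst (g v)) \<ge> 0"
        using uv by (intro e(2)) (auto simp: dist_real_def)
      ultimately show ?thesis
        by (auto simp: s_def zero_le_mult_iff)
    qed simp
    with e(1) show "\<exists>e>0. \<forall>u v. u \<le> t \<and> t \<le> v \<and> v - u < e \<longrightarrow> ?P u v" by blast
  qed
  then show ?thesis by simp
qed

text \<open>
  Continuity of a path in the graph pulls the neighbourhood of local monotonicity back to the
  parameter interval.
\<close>

lemma locally_monotone_along_path:
  assumes "path g" "path_image g \<subseteq> gph T" "\<forall>p \<in> gph T. locally_monotone_sv T p" "t \<in> {0..1}"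
  shows "\<exists>e>0. \<forall>u \<in> {0..1} \<inter> ball t e. \<forall>v \<in> {0..1} \<inter> ball t e.
           (snd (g u) - snd (g v)) * (fst (g u) - fst (g v)) \<ge> 0"
proof -
  have graph: "g u \<in> gph T" if "u \<in> {0..1}" for u
    using assms(2) that by (auto simp: path_image_def)
  obtain W where W: "open W" "g t \<in> W"
    "\<forall>p \<in> gph T \<inter> W. \<forall>q \<in> gph T \<inter> W. (snd p - snd q) * (fst p - fst q) \<ge> 0"
    using assms(3) graph[OF assms(4)] unfolding locally_monotone_sv_def case_prod_beta by blast
  obtain A where A: "open A" "A \<inter> {0..1} = g -` W \<inter> {0..1}"
    using assms(1) W(1) unfolding path_def continuous_on_open_invariant by blast
  then have "t \<in> A" using W assms(4) by auto
  then obtain e where e: "e > 0" "ball t e \<subseteq> A"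
    using A(1) openE by blast
  have "g u \<in> gph T \<inter> W" if "u \<in> {0..1} \<inter> ball t e" for u
    using that e A graph by blast
  then show ?thesis
    using W(3) e(1) by blast
qed

theorem theorem4p4:
  fixes T :: "real \<Rightarrow> real set"
  assumes "proper_map_sv T"
    and "path_connected (gph T)"
    and "\<forall>p \<in> gph T. locally_monotone_sv T p"
  shows "monotone_sv T"
proof -
  have ordered: "fst p \<le> fst q \<and> snd p \<le> snd q"
    if pq: "p \<in> gph T" "q \<in> gph T" "fst p + snd p \<le> fst q + snd q" for p q
  proof (cases "p = q")
    case False
    then obtain g where g: "arc g" "path_image g \<subseteq> gph T" "pathstart g = p" "pathfinish g = q"
      using assms(2) pq unfolding path_connected_arcwise by blast
    show ?thesis
      using arc_locally_comparable_imp_le[OF g(1)]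
        locally_monotone_along_path[OF arc_imp_path[OF g(1)] g(2) assms(3)] pq(3) g(3,4)
      by (auto simp: pathstart_def pathfinish_def)
  qed simp
  have "(snd p - snd q) * (fst p - fst q) \<ge> 0" if "p \<in> gph T" "q \<in> gph T" for p q
    using ordered[OF that] ordered[OF that(2,1)] unfolding zero_le_mult_iff by linarith
  then show ?thesis
    unfolding monotone_sv_def case_prod_beta by blast
qed

end
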